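(* Let $X$ be a strongly paracompact metrizable space. Then the following are equivalent: 1. $X$ is countable-dimensional. 2. $TWO\uparrow G_c(\mathcal O,\mathcal O)$. 3. $TWO\uparrow_{\mathrm{mark}} G_c(\mathcal O,\mathcal O)$. 4. $TWO\uparrow G_1(\mathcal O_{zd},\mathcal O)$. 5. $TWO\uparrow_{\mathrm{mark}} G_1(\mathcal O_{zd},\mathcal O)$. 6. $ONE\uparrow G_1(\mathcal N_{zd},\neg\mathcal O)$. 7. $ONE\uparrow_{\mathrm{pre}} G_1(\mathcal N_{zd},\neg\mathcal O)$.
   Context: A space is strongly paracompact if every open cover has an open refinement that covers the space and is star-finite (each member of the refinement meets only finitely many other members). A space is zero-dim if every open cover admits a refining open cover consisting of pairwise disjoint open sets. A subset of $X$ is zero-dimensional ("zd") if it is zero-dim in its subspace topology. $X$ is countable-dimensional if it is a countable union of zero-dimensional subspaces. Let $\mathcal T$ be the topology of $X$ and $\mathcal O$ the collection of open covers of $X$. The game $G_c(\mathcal O,\mathcal O)$: in each round $n<\omega$, ONE chooses $\mathcal U_n\in\mathcal O$, then TWO chooses a pairwise disjoint collection $\mathcal V_n$ of open sets, each contained in some member of $\mathcal U_n$ (not required to cover $X$). TWO wins if $\bigcup\{\mathcal V_n:n<\omega\}$ covers $X$; ONE wins otherwise. For a collection $\mathcal A$ of subsets of $X$ let $\mathcal O_{\mathcal A}=\{\mathcal U\subseteq\mathcal T:\forall A\in\mathcal A\ \exists U\in\mathcal U\ (A\subseteq U)\}$, $B_A=\{U\in\mathcal T:A\subseteq U\}$,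 and $\mathcal N_{\mathcal A}=\{B_A:A\in\mathcal A\}$. The subscript $zd$ means that $\mathcal A$ is the collection of all zero-dimensional subsets of $X$. The game $G_1(\mathcal O_{\mathcal A},\mathcal O)$: in each round $n<\omega$, ONE chooses $\mathcal U_n\in\mathcal O_{\mathcal A}$, then TWO chooses $V_n\in\mathcal U_n$. TWO wins if $\{V_n:n<\omega\}$ covers $X$; ONE wins otherwise. The game $G_1(\mathcal N_{\mathcal A},\neg\mathcal O)$: in each round $n<\omega$, ONE chooses $B_{A_n}\in\mathcal N_{\mathcal A}$, then TWO chooses $V_n\in B_{A_n}$. TWO wins if $\{V_n:n<\omega\}$ fails to cover $X$; ONE wins otherwise. Strategies. A (perfect-information) strategy for a player chooses each move as a function of the finite sequence of all the opponent's moves made so far; $P\uparrow G$ means player $P$ has a strategy in $G$ that wins against every play of the opponent. A Markov strategy chooses each move as a function only of the most recent move of the opponent and the current round number; $P\uparrow_{\mathrm{mark}}G$ means $P$ has a winning Markov strategy. A predetermined strategy chooses each move as a function only of the current round number; $P\uparrow_{\mathrm{pre}}G$ means $P$ has a winning predetermined strategy. *)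

theory Defs
  imports "HOL-Analysis.Analysis"
begin

definition refines :: "'a set set \<Rightarrow> 'a set set \<Rightarrow> bool" where
  "refines \<V> \<U> \<longleftrightarrow> (\<forall>V\<in>\<V>. \<exists>U\<in>\<U>. V \<subseteq> U)"

definition open_covers :: "'a topology \<Rightarrow> 'a set set set" where
  "open_covers X = {\<U>. (\<forall>U\<in>\<U>. openin X U) \<and> \<Union>\<U> = topspace X}"

definition star_finite :: "'a set set \<Rightarrow> bool" where
  "star_finite \<V> \<longleftrightarrow> (\<forall>V\<in>\<V>. finite {W\<in>\<V>. V \<inter> W \<noteq> {}})"

definition strongly_paracompact :: "'a topology \<Rightarrow> bool" where
  "strongly_paracompact X \<longleftrightarrow>
     (\<forall>\<U>\<in>open_covers X. \<exists>\<V>\<in>open_covers X. refines \<V> \<U> \<and> star_finite \<V>)"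

definition zero_dim :: "'a topology \<Rightarrow> bool" where
  "zero_dim X \<longleftrightarrow>
     (\<forall>\<U>\<in>open_covers X. \<exists>\<V>\<in>open_covers X. refines \<V> \<U> \<and> pairwise disjnt \<V>)"

definition zd_subsets :: "'a topology \<Rightarrow> 'a set set" where
  "zd_subsets X = {A. A \<subseteq> topspace X \<and> zero_dim (subtopology X A)}"

definition countable_dimensional :: "'a topology \<Rightarrow> bool" where
  "countable_dimensional X \<longleftrightarrow>
     (\<exists>\<F>. countable \<F> \<and> \<F> \<subseteq> zd_subsets X \<and> \<Union>\<F> = topspace X)"

text \<open>In each round ONE plays some \<open>m \<in> one_moves G\<close> and TWO answers with an element of
  \<open>two_moves G m\<close>. In the games below the winner depends only on the sequence of TWO's moves.\<close>

record ('m, 'n) game =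
  one_moves :: "'m set"
  two_moves :: "'m \<Rightarrow> 'n set"
  two_wins :: "(nat \<Rightarrow> 'n) \<Rightarrow> bool"

text \<open>A winning strategy must prescribe legal moves. The list \<open>map u [0..<n]\<close> holds the first
  \<open>n\<close> moves of the opponent \<open>u\<close>.\<close>

definition two_has_winning_strategy :: "('m, 'n) game \<Rightarrow> bool" where
  "two_has_winning_strategy G \<longleftrightarrow>
     (\<exists>\<sigma> :: 'm list \<Rightarrow> 'n. \<forall>u. (\<forall>n. u n \<in> one_moves G) \<longrightarrow>
        (\<forall>n. \<sigma> (map u [0..<Suc n]) \<in> two_moves G (u n)) \<and>
        two_wins G (\<lambda>n. \<sigma> (map u [0..<Suc n])))"

definition two_has_winning_markov_strategy :: "('m, 'n) game \<Rightarrow> bool" where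
  "two_has_winning_markov_strategy G \<longleftrightarrow>
     (\<exists>\<sigma> :: 'm \<Rightarrow> nat \<Rightarrow> 'n. \<forall>u. (\<forall>n. u n \<in> one_moves G) \<longrightarrow>
        (\<forall>n. \<sigma> (u n) n \<in> two_moves G (u n)) \<and>
        two_wins G (\<lambda>n. \<sigma> (u n) n))"

text \<open>For ONE, legality is required after every finite history consistent with the strategy, and not
  merely along complete plays: a strategy leaving TWO without an answer would admit no complete
  play and would win vacuously.\<close>

definition one_has_winning_strategy :: "('m, 'n) game \<Rightarrow> bool" where
  "one_has_winning_strategy G \<longleftrightarrow>
     (\<exists>\<sigma> :: 'n list \<Rightarrow> 'm. \<forall>v.
        (\<forall>n. (\<forall>i<n. v i \<in> two_moves G (\<sigma> (map v [0..<i]))) \<longrightarrow>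
             \<sigma> (map v [0..<n]) \<in> one_moves G) \<and>
        ((\<forall>n. v n \<in> two_moves G (\<sigma> (map v [0..<n]))) \<longrightarrow> \<not> two_wins G v))"

definition one_has_winning_predetermined_strategy :: "('m, 'n) game \<Rightarrow> bool" where
  "one_has_winning_predetermined_strategy G \<longleftrightarrow>
     (\<exists>\<sigma> :: nat \<Rightarrow> 'm. (\<forall>n. \<sigma> n \<in> one_moves G) \<and>
        (\<forall>v. (\<forall>n. v n \<in> two_moves G (\<sigma> n)) \<longrightarrow> \<not> two_wins G v))"

definition game_Gc_O_O :: "'a topology \<Rightarrow> ('a set set, 'a set set) game" where
  "game_Gc_O_O X =
     \<lparr> one_moves = open_covers X,
       two_moves = (\<lambda>\<U>. {\<V>. (\<forall>V\<in>\<V>. openin X V) \<and> pairwise disjnt \<V> \<and> refines \<V> \<U>}),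
       two_wins = (\<lambda>\<V>. (\<Union>n. \<V> n) \<in> open_covers X) \<rparr>"

definition G1 :: "'m set set \<Rightarrow> 'm set set \<Rightarrow> ('m set, 'm) game" where
  "G1 \<A> \<B> = \<lparr> one_moves = \<A>, two_moves = (\<lambda>U. U), two_wins = (\<lambda>v. range v \<in> \<B>) \<rparr>"

definition covers_at :: "'a topology \<Rightarrow> 'a set set \<Rightarrow> 'a set set set" where
  "covers_at X \<A> = {\<U>. (\<forall>U\<in>\<U>. openin X U) \<and> (\<forall>A\<in>\<A>. \<exists>U\<in>\<U>. A \<subseteq> U)}"

definition nhds_of_set :: "'a topology \<Rightarrow> 'a set \<Rightarrow> 'a set set" where
  "nhds_of_set X A = {U. openin X U \<and> A \<subseteq> U}"

definition nhds_families :: "'a topology \<Rightarrow> 'a set set \<Rightarrow> 'a set set set" where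
  "nhds_families X \<A> = nhds_of_set X ` \<A>"

text \<open>TWO's target \<open>\<not> \<O>\<close> is the complement of \<open>\<O>\<close>: since every legal move is open, the sets TWO
  chose form a member of it exactly when they fail to cover the space.\<close>

definition game_G1_O_O :: "'a topology \<Rightarrow> 'a set set \<Rightarrow> ('a set set, 'a set) game" where
  "game_G1_O_O X \<A> = G1 (covers_at X \<A>) (open_covers X)"

definition game_G1_N_notO :: "'a topology \<Rightarrow> 'a set set \<Rightarrow> ('a set set, 'a set) game" where
  "game_G1_N_notO X \<A> = G1 (nhds_families X \<A>) (- open_covers X)"

end

theory Submission
  imports Defs
begin

text \<open>
  Two facts about a metric space carry the proof.

  The first one, \<open>zd_Inter_Union_disjoint_small\<close>, produces zero-dimensional sets: if, for every
  \<open>n\<close>, the disjoint family \<open>\<V> n\<close> consists of open sets that lie in balls of radius \<open>1 / (n + 1)\<close>,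
  then the set of the points covered by all these families is zero-dimensional. Indeed the common refinements of the first \<open>n\<close>
  families form a tree of cells, and the maximal cells that lie inside members of a given open
  cover are a disjoint refinement of it. The second one, \<open>zd_disjoint_open_expansion\<close>, says that a
  disjoint refinement on a zero-dimensional subspace can be thickened to a disjoint open family of
  the whole space. Together they place every zero-dimensional set in a zero-dimensional
  \<open>G\<^sub>\<delta>\<close>-set (\<open>zd_Gdelta_enlargement\<close>).

  If \<open>X\<close> is the union of zero-dimensional sets \<open>A\<^sub>0, A\<^sub>1, \<dots>\<close>, then the player in charge
  only has to take care of \<open>A\<^sub>n\<close> in round \<open>n\<close>, which needs no memory. This gives the Markov and
  predetermined strategies, and these are special strategies.

  Conversely, a winning strategy is confronted with countably many opposing moves in each round, so
  that the histories are indexed by finite sequences \<open>s\<close> of natural numbers. Let \<open>U s n\<close> be the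
  set taken care of when move \<open>n\<close> follows the history \<open>s\<close>. A point that is outside \<open>\<Inter>n. U s n\<close> for
  all \<open>s\<close> would be missed along some branch, and the strategy would lose; so the countably many
  sets \<open>\<Inter>n. U s n\<close> cover \<open>X\<close>. It remains to choose the moves so that these sets are
  zero-dimensional. In \<open>G\<^sub>c(\<O>, \<O>)\<close>, ONE plays the covers by balls of radius
  \<open>1 / (n + 1)\<close>, and the first fact applies. In \<open>G\<^sub>1(\<N>, \<not>\<O>)\<close>, TWO answers \<open>B\<^sub>A\<close> with open
  sets whose intersection is a zero-dimensional \<open>G\<^sub>\<delta>\<close>-set around \<open>A\<close>. Finally, a
  winning strategy of TWO in \<open>G\<^sub>1(\<O>\<^sub>\<A>, \<O>)\<close> yields one of ONE in \<open>G\<^sub>1(\<N>\<^sub>\<A>, \<not>\<O>)\<close>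
  by the usual duality.
\<close>

section \<open>Zero-dimensional subsets of metric spaces\<close>

lemma empty_zd: "{} \<in> zd_subsets X"
proof -
  have "{} \<in> open_covers (subtopology X {})"
    by (simp add: open_covers_def)
  then show ?thesis
    unfolding zd_subsets_def zero_dim_def refines_def by force
qed

text \<open>The sets \<open>cell n x\<close>, the intersections of the members around \<open>x\<close> of the families
  \<open>\<V> 0, \<dots>, \<V> n\<close>, shrink to \<open>x\<close> and form a tree under inclusion. This replaces any appeal to
  paracompactness when disjoint refinements are constructed.\<close>

lemma (in Metric_space) zd_Inter_Union_disjoint_small:
  fixes \<V> :: "nat \<Rightarrow> 'a set set"
  assumes op: "\<And>n V. V \<in> \<V> n \<Longrightarrow> openin mtopology V"
    and disj: "\<And>n. pairwise disjnt (\<V> n)"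
    and small: "\<And>n V. V \<in> \<V> n \<Longrightarrow> \<exists>x\<in>M. V \<subseteq> mball x (1 / real (Suc n))"
  shows "(\<Inter>n. \<Union>(\<V> n)) \<in> zd_subsets mtopology"
proof -
  define C where "C = (\<Inter>n. \<Union>(\<V> n))"
  have C_M: "C \<subseteq> M"
    using op[THEN openin_subset] unfolding C_def by fastforce
  have "\<forall>n x. \<exists>V. x \<in> C \<longrightarrow> V \<in> \<V> n \<and> x \<in> V"
    unfolding C_def by blast
  then obtain v where v: "\<And>n x. x \<in> C \<Longrightarrow> v n x \<in> \<V> n" "\<And>n x. x \<in> C \<Longrightarrow> x \<in> v n x"
    by metis
  define cell where "cell n x = C \<inter> (\<Inter>k\<le>n. v k x)" for n x
  have cell_open: "openin (subtopology mtopology C) (cell n x)" if "x \<in> C" for n x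
    unfolding cell_def using op v(1) that by (intro openin_subtopology_Int2 openin_INT2) auto
  have cell_self: "x \<in> cell n x" if "x \<in> C" for n x
    using v(2) that by (auto simp: cell_def)
  have cell_eq: "cell m y = cell m x" if "x \<in> C" "y \<in> cell n x" "m \<le> n" for x y m n
  proof -
    have "v k y = v k x" if "k \<le> n" for k
    proof -
      have "y \<in> C" "y \<in> v k x"
        using \<open>y \<in> cell n x\<close> that by (auto simp: cell_def)
      with v[of y k] v(1)[OF \<open>x \<in> C\<close>, of k] disj[of k] show ?thesis
        by (auto simp: pairwise_def disjnt_iff)
    qed
    with \<open>m \<le> n\<close> show ?thesis by (simp add: cell_def)
  qed
  have "\<exists>\<W>\<in>open_covers (subtopology mtopology C). refines \<W> \<U> \<and> pairwise disjnt \<W>"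
    if \<U>: "\<U> \<in> open_covers (subtopology mtopology C)" for \<U>
  proof -
    have ex: "\<exists>n. \<exists>u\<in>\<U>. cell n x \<subseteq> u" if "x \<in> C" for x
    proof -
      have "x \<in> \<Union>\<U>"
        using \<U> \<open>x \<in> C\<close> C_M by (auto simp: open_covers_def)
      with \<U> obtain u where u: "u \<in> \<U>" "x \<in> u" "openin (subtopology mtopology C) u"
        unfolding open_covers_def by blast
      then obtain T where T: "openin mtopology T" "u = T \<inter> C"
        by (auto simp: openin_subtopology)
      with u obtain r where r: "r > 0" "mball x r \<subseteq> T"
        by (auto simp: openin_mtopology)
      obtain n where n: "1 / real (Suc n) < r / 2"
        using r(1) nat_approx_posE[of "r/2"] by auto
      obtain z where z: "z \<in> M" "v n x \<subseteq> mball z (1 / real (Suc n))"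
        using small v(1)[OF \<open>x \<in> C\<close>] by metis
      have "cell n x \<subseteq> mball x r"
      proof
        fix y assume "y \<in> cell n x"
        then have "y \<in> mball z (1 / real (Suc n))" "x \<in> mball z (1 / real (Suc n))"
          using z(2) v(2)[OF \<open>x \<in> C\<close>, of n] by (auto simp: cell_def)
        with n triangle[of x z y] show "y \<in> mball x r"
          by (auto simp: commute)
      qed
      then have "cell n x \<subseteq> u"
        using r T by (auto simp: cell_def)
      with u(1) show ?thesis by blast
    qed
    \<comment> \<open>The cell \<open>cell (N x) x\<close> is the largest one around \<open>x\<close> that refines \<open>\<U>\<close>; two such cells that
      meet are comparable, and by maximality they coincide.\<close>
    define N where "N x = (LEAST n. \<exists>u\<in>\<U>. cell n x \<subseteq> u)" for x
    define \<W> where "\<W> = (\<lambda>x. cell (N x) x) ` C"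
    have N_ref: "\<exists>u\<in>\<U>. cell (N x) x \<subseteq> u" if "x \<in> C" for x
      unfolding N_def using ex[OF that] by (rule LeastI_ex)
    have N_le: "N x \<le> n" if "u \<in> \<U>" "cell n x \<subseteq> u" for x n u
      unfolding N_def using that by (intro Least_le) blast
    have meet: "cell (N x) x = cell (N x') x'"
      if "x \<in> C" "x' \<in> C" "y \<in> cell (N x) x" "y \<in> cell (N x') x'" "N x \<le> N x'" for x x' y
    proof -
      have same: "cell (N x) x = cell (N x) x'"
        using cell_eq[OF that(1,3)] cell_eq[OF that(2,4,5)] by simp
      with N_ref[OF that(1)] N_le have "N x' \<le> N x"
        by metis
      with same that(5) show ?thesis by simp
    qed
    have "pairwise disjnt \<W>"
    proof (rule pairwiseI, rule ccontr)
      fix P Q assume PQ: "P \<in> \<W>" "Q \<in> \<W>" "P \<noteq> Q" "\<not> disjnt P Q"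
      then obtain x x' y where "x \<in> C" "x' \<in> C" "P = cell (N x) x" "Q = cell (N x') x'"
        "y \<in> P" "y \<in> Q"
        by (auto simp: \<W>_def disjnt_iff)
      with meet[of x x' y] meet[of x' x y] \<open>P \<noteq> Q\<close> show False
        by (metis nat_le_linear)
    qed
    moreover have "\<Union>\<W> = C"
      using cell_self by (auto simp: \<W>_def cell_def)
    then have "\<W> \<in> open_covers (subtopology mtopology C)"
      using cell_open C_M by (auto simp: open_covers_def \<W>_def)
    moreover have "refines \<W> \<U>"
      using N_ref by (auto simp: refines_def \<W>_def)
    ultimately show ?thesis by blast
  qed
  with C_M show ?thesis
    unfolding C_def[symmetric] zd_subsets_def zero_dim_def by auto
qed

text \<open>A disjoint family of relatively open subsets of \<open>A\<close> becomes a disjoint family of open sets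
  when each of its points is replaced by a ball of half the radius that its member allows within
  \<open>A\<close>.\<close>

lemma zd_disjoint_open_expansion:
  assumes X: "metrizable_space X" and A: "A \<in> zd_subsets X" and \<U>: "\<U> \<in> open_covers X"
  shows "\<exists>\<V>. (\<forall>V\<in>\<V>. openin X V) \<and> pairwise disjnt \<V> \<and> refines \<V> \<U> \<and> A \<subseteq> \<Union>\<V>"
proof -
  from X obtain M d where "Metric_space M d" and X_eq: "X = Metric_space.mtopology M d"
    unfolding metrizable_space_def by blast
  then interpret Metric_space M d by blast
  have A_M: "A \<subseteq> M"
    using A by (simp add: zd_subsets_def X_eq)
  have "(\<lambda>U. A \<inter> U) ` \<U> \<in> open_covers (subtopology X A)"
    using \<U> by (auto simp: open_covers_def openin_subtopology_Int2)
  then obtain \<W> where \<W>: "\<W> \<in> open_covers (subtopology X A)"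
      "refines \<W> ((\<lambda>U. A \<inter> U) ` \<U>)" "pairwise disjnt \<W>"
    using A by (auto simp: zd_subsets_def zero_dim_def)
  have \<W>_Union: "\<Union>\<W> = A"
    using \<W>(1) A_M by (auto simp: open_covers_def X_eq)
  have "\<exists>U\<in>\<U>. W \<subseteq> U" if "W \<in> \<W>" for W
    using bspec[OF \<W>(2)[unfolded refines_def] that] by auto
  then obtain u where u: "\<And>W. W \<in> \<W> \<Longrightarrow> u W \<in> \<U>" "\<And>W. W \<in> \<W> \<Longrightarrow> W \<subseteq> u W"
    by metis
  have "\<exists>r>0. mball x r \<inter> A \<subseteq> W" if "W \<in> \<W>" "x \<in> W" for W x
  proof -
    have "openin (subtopology mtopology A) W"
      using \<W>(1) that by (auto simp: open_covers_def X_eq)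
    then obtain T where T: "openin mtopology T" "W = T \<inter> A"
      by (auto simp: openin_subtopology)
    with that obtain r where "r > 0" "mball x r \<subseteq> T"
      by (auto simp: openin_mtopology)
    with T show ?thesis by blast
  qed
  then obtain r where r: "\<And>W x. W \<in> \<W> \<Longrightarrow> x \<in> W \<Longrightarrow> r W x > 0"
      "\<And>W x. W \<in> \<W> \<Longrightarrow> x \<in> W \<Longrightarrow> mball x (r W x) \<inter> A \<subseteq> W"
    by metis
  define E where "E W = u W \<inter> (\<Union>x\<in>W. mball x (r W x / 2))" for W
  have E_open: "openin X (E W)" if "W \<in> \<W>" for W
  proof -
    have "openin X (u W)"
      using \<U> u(1)[OF that] unfolding open_covers_def by blast
    then show ?thesis
      unfolding E_def X_eq by (intro openin_Int openin_Union) auto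
  qed
  have \<W>_E: "W \<subseteq> E W" if "W \<in> \<W>" for W
    using u(2) r(1) that \<W>_Union A_M by (force simp: E_def)
  have close: "y \<in> W"
    if "W \<in> \<W>" "W' \<in> \<W>" "x \<in> W" "y \<in> W'" "z \<in> mball x (r W x / 2)" "z \<in> mball y (r W' y / 2)"
      "r W' y \<le> r W x" for W W' x y z
  proof -
    have "y \<in> A" "y \<in> mball x (r W x)"
      using that \<W>_Union triangle[of x z y] by (auto simp: commute)
    with r(2) that show ?thesis by blast
  qed
  have E_disj: "W = W'" if "W \<in> \<W>" "W' \<in> \<W>" "z \<in> E W" "z \<in> E W'" for W W' z
  proof -
    obtain x y where "x \<in> W" "y \<in> W'" "z \<in> mball x (r W x / 2)" "z \<in> mball y (r W' y / 2)"
      using \<open>z \<in> E W\<close> \<open>z \<in> E W'\<close> unfolding E_def by blast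
    with that close have "y \<in> W \<or> x \<in> W'"
      by (meson linear)
    with \<open>x \<in> W\<close> \<open>y \<in> W'\<close> \<open>W \<in> \<W>\<close> \<open>W' \<in> \<W>\<close> \<W>(3) show ?thesis
      by (auto simp: pairwise_def disjnt_iff)
  qed
  have "pairwise disjnt (E ` \<W>)"
    using E_disj by (auto simp: pairwise_def disjnt_iff)
  moreover have "refines (E ` \<W>) \<U>"
    using u(1) by (auto simp: refines_def E_def)
  moreover have "A \<subseteq> \<Union>(E ` \<W>)"
    using \<W>_E \<W>_Union by blast
  ultimately show ?thesis
    using E_open by (intro exI[of _ "E ` \<W>"]) auto
qed

lemma (in Metric_space) balls_open_cover:
  assumes "r > 0"
  shows "(\<lambda>x. mball x r) ` M \<in> open_covers mtopology"
  using assms by (force simp: open_covers_def)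

text \<open>The zero-dimensional case of Tumarkin's enlargement theorem: thickened disjoint refinements of
  the covers by balls of radius \<open>1 / (n + 1)\<close> provide the neighbourhoods.\<close>

lemma zd_Gdelta_enlargement:
  assumes X: "metrizable_space X" and A: "A \<in> zd_subsets X"
  shows "\<exists>W :: nat \<Rightarrow> 'a set. (\<forall>n. W n \<in> nhds_of_set X A) \<and> (\<Inter>n. W n) \<in> zd_subsets X"
proof -
  from X obtain M d where "Metric_space M d" and X_eq: "X = Metric_space.mtopology M d"
    unfolding metrizable_space_def by blast
  then interpret Metric_space M d by blast
  have "\<exists>\<V>. (\<forall>V\<in>\<V>. openin X V) \<and> pairwise disjnt \<V> \<and>
      refines \<V> ((\<lambda>x. mball x (1 / real (Suc n))) ` M) \<and> A \<subseteq> \<Union>\<V>" for n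
    using balls_open_cover by (intro zd_disjoint_open_expansion[OF X A]) (simp add: X_eq)
  then obtain \<V> where \<V>: "\<And>n V. V \<in> \<V> n \<Longrightarrow> openin X V" "\<And>n. pairwise disjnt (\<V> n)"
      "\<And>n. refines (\<V> n) ((\<lambda>x. mball x (1 / real (Suc n))) ` M)" "\<And>n. A \<subseteq> \<Union>(\<V> n)"
    by metis
  have "(\<Inter>n. \<Union>(\<V> n)) \<in> zd_subsets X"
    unfolding X_eq using \<V>(1-3)
    by (intro zd_Inter_Union_disjoint_small) (auto simp: X_eq refines_def)
  then show ?thesis
    using \<V>(1,4) by (intro exI[of _ "\<lambda>n. \<Union>(\<V> n)"]) (auto simp: nhds_of_set_def)
qed

section \<open>Strategies and trees of histories\<close>

text \<open>The list of answers produced by the rule \<open>F\<close>, which looks at its own earlier answers and at the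
  current input; it translates a history of one game into a history of another one.\<close>

definition answers :: "('b list \<Rightarrow> 'a \<Rightarrow> 'b) \<Rightarrow> 'a list \<Rightarrow> 'b list" where
  "answers F = foldl (\<lambda>h a. h @ [F h a]) []"

lemma answers_map_upt:
  "answers F (map v [0..<n]) = map (\<lambda>i. F (answers F (map v [0..<i])) (v i)) [0..<n]"
  by (induction n) (simp_all add: answers_def)

lemma exists_history_dependent_sequence:
  fixes g :: "'a list \<Rightarrow> 'a"
  shows "\<exists>f. \<forall>n. f n = g (map f [0..<n])"
proof -
  define h where "h = rec_nat [] (\<lambda>_ s. s @ [g s])"
  define f where "f n = g (h n)" for n
  have "h n = map f [0..<n]" for n
    by (induction n) (simp_all add: h_def f_def)
  then show ?thesis
    unfolding f_def by metis
qed

text \<open>A point outside all the sets \<open>\<Inter>n. U s n\<close> could be avoided at every node \<open>s\<close>, and the branch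
  that follows these choices would not cover it.\<close>

lemma countable_dimensional_if_branches_cover:
  fixes U :: "nat list \<Rightarrow> nat \<Rightarrow> 'a set"
  assumes zd: "\<And>s. (\<Inter>n. U s n) \<in> zd_subsets X"
    and branch: "\<And>f. topspace X \<subseteq> (\<Union>n. U (map f [0..<n]) (f n))"
  shows "countable_dimensional X"
proof -
  have "topspace X \<subseteq> (\<Union>s. \<Inter>n. U s n)"
  proof (rule ccontr)
    assume "\<not> ?thesis"
    then obtain x where x: "x \<in> topspace X" "\<forall>s. \<exists>n. x \<notin> U s n"
      by blast
    from x(2) obtain g where g: "\<And>s. x \<notin> U s (g s)"
      by metis
    obtain f where f: "\<forall>n. f n = g (map f [0..<n])"
      using exists_history_dependent_sequence[of g] by blast
    have "x \<notin> U (map f [0..<n]) (f n)" for n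
      using g[of "map f [0..<n]"] f[rule_format, of n] by simp
    then have "x \<notin> (\<Union>n. U (map f [0..<n]) (f n))"
      by blast
    with branch x(1) show False by blast
  qed
  moreover have "(\<Inter>n. U s n) \<subseteq> topspace X" for s
    using zd unfolding zd_subsets_def by blast
  ultimately have "\<Union>(range (\<lambda>s. \<Inter>n. U s n)) = topspace X"
    by blast
  moreover have "range (\<lambda>s. \<Inter>n. U s n) \<subseteq> zd_subsets X"
    using zd by blast
  moreover have "countable (range (\<lambda>s. \<Inter>n. U s n))"
    by simp
  ultimately show ?thesis
    unfolding countable_dimensional_def by blast
qed

lemma countable_dimensional_sequence:
  assumes "countable_dimensional X"
  shows "\<exists>A :: nat \<Rightarrow> 'a set. range A \<subseteq> zd_subsets X \<and> (\<Union>n. A n) = topspace X"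
proof -
  obtain \<F> where \<F>: "countable \<F>" "\<F> \<subseteq> zd_subsets X" "\<Union>\<F> = topspace X"
    using assms unfolding countable_dimensional_def by (elim exE conjE) (rule that)
  \<comment> \<open>Adding the empty set makes the family nonempty, so that it can be enumerated.\<close>
  have range: "range (from_nat_into (insert {} \<F>)) = insert {} \<F>"
    using \<F>(1) by (intro range_from_nat_into) auto
  show ?thesis
  proof (intro exI conjI)
    show "range (from_nat_into (insert {} \<F>)) \<subseteq> zd_subsets X"
      using \<F>(2) empty_zd by (simp add: range)
    show "\<Union>(range (from_nat_into (insert {} \<F>))) = topspace X"
      using \<F>(3) by (simp add: range)
  qed
qed

lemma two_has_winning_strategy_if_markov:
  assumes "two_has_winning_markov_strategy G"
  shows "two_has_winning_strategy G"
proof -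
  obtain \<sigma> where \<sigma>: "\<forall>u. (\<forall>n. u n \<in> one_moves G) \<longrightarrow>
      (\<forall>n. \<sigma> (u n) n \<in> two_moves G (u n)) \<and> two_wins G (\<lambda>n. \<sigma> (u n) n)"
    using assms unfolding two_has_winning_markov_strategy_def by blast
  show ?thesis
    unfolding two_has_winning_strategy_def
    using \<sigma> by (intro exI[of _ "\<lambda>h. \<sigma> (last h) (length h - 1)"]) simp
qed

lemma one_has_winning_strategy_if_predetermined:
  assumes "one_has_winning_predetermined_strategy G"
  shows "one_has_winning_strategy G"
proof -
  obtain \<sigma> where \<sigma>: "\<forall>n. \<sigma> n \<in> one_moves G"
      "\<forall>v. (\<forall>n. v n \<in> two_moves G (\<sigma> n)) \<longrightarrow> \<not> two_wins G v"
    using assms unfolding one_has_winning_predetermined_strategy_def by blast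
  show ?thesis
    unfolding one_has_winning_strategy_def
    using \<sigma> by (intro exI[of _ "\<lambda>h. \<sigma> (length h)"]) simp
qed

section \<open>Memoryless strategies in countable-dimensional spaces\<close>

lemma open_coversI_sequence:
  assumes "\<And>V. V \<in> \<V> \<Longrightarrow> openin X V" and "\<And>n. A n \<subseteq> \<Union>\<V>" and "(\<Union>n. A n) = topspace X"
  shows "\<V> \<in> open_covers X"
proof -
  have "topspace X \<subseteq> \<Union>\<V>"
    using assms(2,3) by blast
  moreover have "\<Union>\<V> \<subseteq> topspace X"
    using assms(1) openin_subset by (metis Union_least)
  ultimately show ?thesis
    using assms(1) by (auto simp: open_covers_def)
qed

lemma Gc_markov_if_countable_dimensional:
  assumes X: "metrizable_space X" and cd: "countable_dimensional X"
  shows "two_has_winning_markov_strategy (game_Gc_O_O X)"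
proof -
  obtain A :: "nat \<Rightarrow> 'a set" where A: "range A \<subseteq> zd_subsets X" "(\<Union>n. A n) = topspace X"
    using countable_dimensional_sequence[OF cd] by blast
  have "\<exists>\<V>. \<U> \<in> open_covers X \<longrightarrow>
      (\<forall>V\<in>\<V>. openin X V) \<and> pairwise disjnt \<V> \<and> refines \<V> \<U> \<and> A n \<subseteq> \<Union>\<V>" for \<U> n
    using zd_disjoint_open_expansion[OF X, of "A n" \<U>] A(1) by blast
  then obtain \<sigma> where \<sigma>: "\<And>\<U> n. \<U> \<in> open_covers X \<Longrightarrow>
      (\<forall>V\<in>\<sigma> \<U> n. openin X V) \<and> pairwise disjnt (\<sigma> \<U> n) \<and> refines (\<sigma> \<U> n) \<U> \<and> A n \<subseteq> \<Union>(\<sigma> \<U> n)"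
    by metis
  have "(\<Union>n. \<sigma> (u n) n) \<in> open_covers X" if u: "\<forall>n. u n \<in> open_covers X" for u
  proof -
    have *: "(\<forall>V\<in>\<sigma> (u n) n. openin X V) \<and> A n \<subseteq> \<Union>(\<sigma> (u n) n)" for n
      using \<sigma>[of "u n" n] u by simp
    show ?thesis
    proof (rule open_coversI_sequence)
      show "A n \<subseteq> \<Union>(\<Union>n. \<sigma> (u n) n)" for n
        using *[of n] by blast
    qed (use * A(2) in auto)
  qed
  then show ?thesis
    unfolding two_has_winning_markov_strategy_def game_Gc_O_O_def
    using \<sigma> by (intro exI[of _ \<sigma>] allI impI conjI) (simp, metis, simp)
qed

lemma G1_O_markov_if_countable_dimensional:
  assumes cd: "countable_dimensional X"
  shows "two_has_winning_markov_strategy (game_G1_O_O X (zd_subsets X))"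
proof -
  obtain A :: "nat \<Rightarrow> 'a set" where A: "range A \<subseteq> zd_subsets X" "(\<Union>n. A n) = topspace X"
    using countable_dimensional_sequence[OF cd] by blast
  have "\<exists>U. \<U> \<in> covers_at X (zd_subsets X) \<longrightarrow> U \<in> \<U> \<and> A n \<subseteq> U" for \<U> n
    using subsetD[OF A(1) rangeI, of n] unfolding covers_at_def by blast
  then obtain \<sigma> where
    \<sigma>: "\<And>\<U> n. \<U> \<in> covers_at X (zd_subsets X) \<Longrightarrow> \<sigma> \<U> n \<in> \<U> \<and> A n \<subseteq> \<sigma> \<U> n"
    by metis
  have "range (\<lambda>n. \<sigma> (u n) n) \<in> open_covers X"
    if u: "\<forall>n. u n \<in> covers_at X (zd_subsets X)" for u
  proof -
    have *: "openin X (\<sigma> (u n) n) \<and> A n \<subseteq> \<sigma> (u n) n" for n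
      using \<sigma>[of "u n" n] u[rule_format, of n] by (simp add: covers_at_def)
    show ?thesis
    proof (rule open_coversI_sequence)
      show "A n \<subseteq> \<Union>(range (\<lambda>n. \<sigma> (u n) n))" for n
        using *[of n] by blast
    qed (use * A(2) in auto)
  qed
  with \<sigma> show ?thesis
    unfolding two_has_winning_markov_strategy_def game_G1_O_O_def G1_def
    by (intro exI[of _ \<sigma>]) simp
qed

lemma G1_N_predetermined_if_countable_dimensional:
  assumes cd: "countable_dimensional X"
  shows "one_has_winning_predetermined_strategy (game_G1_N_notO X (zd_subsets X))"
proof -
  obtain A :: "nat \<Rightarrow> 'a set" where A: "range A \<subseteq> zd_subsets X" "(\<Union>n. A n) = topspace X"
    using countable_dimensional_sequence[OF cd] by blast
  have "range v \<in> open_covers X" if v: "\<forall>n. v n \<in> nhds_of_set X (A n)" for v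
  proof -
    have *: "openin X (v n) \<and> A n \<subseteq> v n" for n
      using v by (simp add: nhds_of_set_def)
    show ?thesis
    proof (rule open_coversI_sequence)
      show "A n \<subseteq> \<Union>(range v)" for n
        using *[of n] by blast
    qed (use * A(2) in auto)
  qed
  with A(1) show ?thesis
    unfolding one_has_winning_predetermined_strategy_def game_G1_N_notO_def G1_def nhds_families_def
    by (intro exI[of _ "\<lambda>n. nhds_of_set X (A n)"]) auto
qed

section \<open>Winning strategies imply countable-dimensionality\<close>

text \<open>If ONE only plays covers by small balls, then the points that TWO covers after the history \<open>s\<close>,
  whatever the size of the next balls, form a zero-dimensional set.\<close>

lemma countable_dimensional_if_Gc:
  assumes X: "metrizable_space X" and win: "two_has_winning_strategy (game_Gc_O_O X)"
  shows "countable_dimensional X"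
proof -
  from X obtain M d where "Metric_space M d" and X_eq: "X = Metric_space.mtopology M d"
    unfolding metrizable_space_def by blast
  then interpret Metric_space M d by blast
  obtain \<sigma> where \<sigma>: "\<forall>u. (\<forall>n. u n \<in> one_moves (game_Gc_O_O X)) \<longrightarrow>
      (\<forall>n. \<sigma> (map u [0..<Suc n]) \<in> two_moves (game_Gc_O_O X) (u n)) \<and>
      two_wins (game_Gc_O_O X) (\<lambda>n. \<sigma> (map u [0..<Suc n]))"
    using win unfolding two_has_winning_strategy_def by blast
  have \<sigma>_legal: "(\<forall>V\<in>\<sigma> (map u [0..<Suc n]). openin X V) \<and>
      pairwise disjnt (\<sigma> (map u [0..<Suc n])) \<and> refines (\<sigma> (map u [0..<Suc n])) (u n)"
    if "\<And>n. u n \<in> open_covers X" for u n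
    using \<sigma>[THEN spec, of u] that by (auto simp add: game_Gc_O_O_def simp del: upt_Suc)
  have \<sigma>_wins: "(\<Union>n. \<sigma> (map u [0..<Suc n])) \<in> open_covers X"
    if "\<And>n. u n \<in> open_covers X" for u
    using \<sigma>[THEN spec, of u] that by (simp add: game_Gc_O_O_def del: upt_Suc)
  define B where "B n = (\<lambda>x. mball x (1 / real (Suc n))) ` M" for n :: nat
  have B: "B n \<in> open_covers X" for n
    unfolding B_def X_eq by (intro balls_open_cover) simp
  have legal: "(\<forall>V\<in>\<sigma> (map B (s @ [n])). openin X V) \<and> pairwise disjnt (\<sigma> (map B (s @ [n]))) \<and>
      refines (\<sigma> (map B (s @ [n]))) (B n)" for s n
  proof -
    define u where "u i = B ((s @ [n]) ! i)" for i
    have "map u [0..<Suc (length s)] = map B (s @ [n])"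
      by (rule nth_equalityI) (auto simp: u_def nth_append less_Suc_eq simp del: upt_Suc)
    moreover have "u (length s) = B n"
      by (simp add: u_def)
    ultimately show ?thesis
      using \<sigma>_legal[of u "length s"] B by (simp add: u_def del: upt_Suc)
  qed
  show ?thesis
  proof (rule countable_dimensional_if_branches_cover)
    fix s :: "nat list"
    show "(\<Inter>n. \<Union>(\<sigma> (map B (s @ [n])))) \<in> zd_subsets X"
      unfolding X_eq
    proof (rule zd_Inter_Union_disjoint_small)
      fix n V assume "V \<in> \<sigma> (map B (s @ [n]))"
      with legal[of s n] show "openin mtopology V" "\<exists>x\<in>M. V \<subseteq> mball x (1 / real (Suc n))"
        by (auto simp: X_eq refines_def B_def)
    qed (use legal in blast)
  next
    fix f :: "nat \<Rightarrow> nat"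
    have "(\<Union>n. \<sigma> (map (B \<circ> f) [0..<Suc n])) \<in> open_covers X"
      using B by (intro \<sigma>_wins) simp
    then have "topspace X \<subseteq> (\<Union>n. \<Union>(\<sigma> (map (B \<circ> f) [0..<Suc n])))"
      unfolding open_covers_def by blast
    then show "topspace X \<subseteq> (\<Union>n. \<Union>(\<sigma> (map B (map f [0..<n] @ [f n]))))"
      by simp
  qed
qed

text \<open>TWO answers the move \<open>B\<^sub>A\<close> only with sets from a sequence of neighbourhoods of \<open>A\<close> whose
  intersection is zero-dimensional.\<close>

lemma countable_dimensional_if_G1_N:
  assumes X: "metrizable_space X"
    and win: "one_has_winning_strategy (game_G1_N_notO X (zd_subsets X))"
  shows "countable_dimensional X"
proof -
  obtain \<sigma> where
    legal: "\<And>v n. (\<And>i. i < n \<Longrightarrow> v i \<in> \<sigma> (map v [0..<i])) \<Longrightarrow>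
        \<sigma> (map v [0..<n]) \<in> nhds_families X (zd_subsets X)"
    and wins: "\<And>v. (\<And>n. v n \<in> \<sigma> (map v [0..<n])) \<Longrightarrow> range v \<in> open_covers X"
    using win unfolding one_has_winning_strategy_def game_G1_N_notO_def G1_def by auto
  \<comment> \<open>At histories where the strategy makes no legal move, the constant sequence \<open>{}\<close> is a harmless
    default that keeps the intersection zero-dimensional.\<close>
  have "\<exists>W :: nat \<Rightarrow> 'a set. (\<Inter>n. W n) \<in> zd_subsets X \<and>
      (\<sigma> h \<in> nhds_families X (zd_subsets X) \<longrightarrow> (\<forall>n. W n \<in> \<sigma> h))" for h
  proof (cases "\<sigma> h \<in> nhds_families X (zd_subsets X)")
    case True
    then obtain A where "A \<in> zd_subsets X" "\<sigma> h = nhds_of_set X A"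
      unfolding nhds_families_def by blast
    with zd_Gdelta_enlargement[OF X] show ?thesis
      by metis
  next
    case False
    then show ?thesis
      using empty_zd by (intro exI[of _ "\<lambda>_. {}"]) simp
  qed
  then obtain W where W_zd: "\<And>h. (\<Inter>n::nat. W h n) \<in> zd_subsets X"
    and W_legal: "\<And>h n. \<sigma> h \<in> nhds_families X (zd_subsets X) \<Longrightarrow> W h n \<in> \<sigma> h"
    by metis
  show ?thesis
  proof (rule countable_dimensional_if_branches_cover)
    fix s
    show "(\<Inter>n. W (answers W s) n) \<in> zd_subsets X"
      by (rule W_zd)
  next
    fix f :: "nat \<Rightarrow> nat"
    define v where "v n = W (answers W (map f [0..<n])) (f n)" for n
    have history: "answers W (map f [0..<n]) = map v [0..<n]" for n
      unfolding v_def by (rule answers_map_upt)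
    have "v n \<in> \<sigma> (map v [0..<n])" for n
    proof (induction n rule: less_induct)
      case (less n)
      then show ?case
        using W_legal[OF legal, of n v "f n"] by (simp add: v_def[of n] history)
    qed
    then have "range v \<in> open_covers X"
      by (rule wins)
    then show "topspace X \<subseteq> (\<Union>n. W (answers W (map f [0..<n])) (f n))"
      unfolding open_covers_def v_def by auto
  qed
qed

text \<open>After any history of covers there is a set \<open>A \<in> \<A>\<close> such that TWO's strategy can be made to
  answer any given open neighbourhood of \<open>A\<close>: otherwise each \<open>A \<in> \<A>\<close> has a neighbourhood that is
  never the answer, and the cover formed by these leaves TWO without an answer. ONE plays such sets
  in the dual game and turns every reply into a cover that would have provoked it.\<close>

lemma G1_duality:
  assumes win: "two_has_winning_strategy (G1 (covers_at X \<A>) \<B>)"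
  shows "one_has_winning_strategy (G1 (nhds_families X \<A>) (- \<B>))"
proof -
  obtain \<sigma> where
    legal: "\<And>u n. (\<And>n. u n \<in> covers_at X \<A>) \<Longrightarrow> \<sigma> (map u [0..<Suc n]) \<in> u n"
    and wins: "\<And>u. (\<And>n. u n \<in> covers_at X \<A>) \<Longrightarrow> range (\<lambda>n. \<sigma> (map u [0..<Suc n])) \<in> \<B>"
    using win unfolding two_has_winning_strategy_def G1_def by auto
  have reply: "\<sigma> (s @ [\<U>]) \<in> \<U>" if "set s \<subseteq> covers_at X \<A>" "\<U> \<in> covers_at X \<A>" for s \<U>
  proof -
    define u where "u i = (if i < length s then s ! i else \<U>)" for i
    have "u i \<in> covers_at X \<A>" for i
      using that by (auto simp: u_def)
    moreover have "map u [0..<Suc (length s)] = s @ [\<U>]"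
      by (rule nth_equalityI) (auto simp: u_def nth_append less_Suc_eq simp del: upt_Suc)
    moreover have "u (length s) = \<U>"
      by (simp add: u_def)
    ultimately show ?thesis
      using legal[of u "length s"] by metis
  qed
  have "\<exists>A\<in>\<A>. \<forall>V\<in>nhds_of_set X A. \<exists>\<U>\<in>covers_at X \<A>. \<sigma> (s @ [\<U>]) = V"
    if s: "set s \<subseteq> covers_at X \<A>" for s
  proof (rule ccontr)
    assume "\<not> ?thesis"
    then have "\<forall>A\<in>\<A>. \<exists>V. V \<in> nhds_of_set X A \<and> (\<forall>\<U>\<in>covers_at X \<A>. \<sigma> (s @ [\<U>]) \<noteq> V)"
      by simp blast
    then obtain V where V: "\<And>A. A \<in> \<A> \<Longrightarrow> V A \<in> nhds_of_set X A"
        "\<And>A \<U>. A \<in> \<A> \<Longrightarrow> \<U> \<in> covers_at X \<A> \<Longrightarrow> \<sigma> (s @ [\<U>]) \<noteq> V A"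
      by metis
    have V_cover: "V ` \<A> \<in> covers_at X \<A>"
      using V(1) by (auto simp: covers_at_def nhds_of_set_def)
    with reply[OF s] obtain A where "A \<in> \<A>" "\<sigma> (s @ [V ` \<A>]) = V A"
      by blast
    with V(2) V_cover show False
      by blast
  qed
  then obtain A where A: "\<And>s. set s \<subseteq> covers_at X \<A> \<Longrightarrow> A s \<in> \<A> \<and>
      (\<forall>V\<in>nhds_of_set X (A s). \<exists>\<U>\<in>covers_at X \<A>. \<sigma> (s @ [\<U>]) = V)"
    by metis
  then have "\<exists>\<U>. set s \<subseteq> covers_at X \<A> \<longrightarrow> V \<in> nhds_of_set X (A s) \<longrightarrow>
      \<U> \<in> covers_at X \<A> \<and> \<sigma> (s @ [\<U>]) = V" for s V
    by blast
  then obtain C where C: "\<And>s V. set s \<subseteq> covers_at X \<A> \<Longrightarrow> V \<in> nhds_of_set X (A s) \<Longrightarrow>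
      C s V \<in> covers_at X \<A> \<and> \<sigma> (s @ [C s V]) = V"
    by metis
  define \<tau> where "\<tau> h = nhds_of_set X (A (answers C h))" for h
  define u where "u v n = C (answers C (map v [0..<n])) (v n)" for v n
  have history: "answers C (map v [0..<n]) = map (u v) [0..<n]" for v n
    unfolding u_def by (rule answers_map_upt)
  have covers: "set (map (u v) [0..<n]) \<subseteq> covers_at X \<A>"
    if "\<forall>i<n. v i \<in> \<tau> (map v [0..<i])" for v n
    using that
  proof (induction n)
    case (Suc n)
    then have "set (map (u v) [0..<n]) \<subseteq> covers_at X \<A>"
      by simp
    moreover have "v n \<in> nhds_of_set X (A (map (u v) [0..<n]))"
      using Suc.prems by (simp add: \<tau>_def history)
    ultimately have "u v n \<in> covers_at X \<A>"
      using C by (simp add: u_def[of v n] history del: set_map)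
    with \<open>set (map (u v) [0..<n]) \<subseteq> covers_at X \<A>\<close> show ?case
      by simp
  qed simp
  have "\<tau> (map v [0..<n]) \<in> nhds_families X \<A>" if "\<forall>i<n. v i \<in> \<tau> (map v [0..<i])" for v n
    using A[OF covers[OF that]] by (simp add: \<tau>_def history nhds_families_def)
  moreover have "range v \<in> \<B>" if v: "\<forall>n. v n \<in> \<tau> (map v [0..<n])" for v
  proof -
    have prefix: "set (map (u v) [0..<n]) \<subseteq> covers_at X \<A>" for n
      using covers v by blast
    have "v n \<in> nhds_of_set X (A (map (u v) [0..<n]))" for n
      using v by (simp add: \<tau>_def history)
    then have step: "u v n \<in> covers_at X \<A> \<and> \<sigma> (map (u v) [0..<n] @ [u v n]) = v n" for n
      using C[OF prefix] by (simp add: u_def[of v n] history)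
    then have "v = (\<lambda>n. \<sigma> (map (u v) [0..<Suc n]))"
      by simp
    with wins[of "u v"] step show ?thesis
      by metis
  qed
  ultimately show ?thesis
    unfolding one_has_winning_strategy_def G1_def
    by (intro exI[of _ \<tau>]) simp
qed

section \<open>The equivalence\<close>

theorem theorem3p16:
  fixes X :: "'a topology"
  assumes "metrizable_space X" and "strongly_paracompact X"
  shows
    "(countable_dimensional X \<longleftrightarrow> two_has_winning_strategy (game_Gc_O_O X)) \<and>
     (countable_dimensional X \<longleftrightarrow> two_has_winning_markov_strategy (game_Gc_O_O X)) \<and>
     (countable_dimensional X \<longleftrightarrow> two_has_winning_strategy (game_G1_O_O X (zd_subsets X))) \<and>
     (countable_dimensional X \<longleftrightarrow> two_has_winning_markov_strategy (game_G1_O_O X (zd_subsets X))) \<and>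
     (countable_dimensional X \<longleftrightarrow> one_has_winning_strategy (game_G1_N_notO X (zd_subsets X))) \<and>
     (countable_dimensional X \<longleftrightarrow> one_has_winning_predetermined_strategy (game_G1_N_notO X (zd_subsets X)))"
proof -
  note X = assms(1)
  have "two_has_winning_strategy (game_G1_O_O X (zd_subsets X)) \<Longrightarrow>
      one_has_winning_strategy (game_G1_N_notO X (zd_subsets X))"
    unfolding game_G1_O_O_def game_G1_N_notO_def by (rule G1_duality)
  then show ?thesis
    using Gc_markov_if_countable_dimensional[OF X] G1_O_markov_if_countable_dimensional[of X]
      G1_N_predetermined_if_countable_dimensional[of X]
      two_has_winning_strategy_if_markov[of "game_Gc_O_O X"]
      two_has_winning_strategy_if_markov[of "game_G1_O_O X (zd_subsets X)"]
      one_has_winning_strategy_if_predetermined[of "game_G1_N_notO X (zd_subsets X)"]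
      countable_dimensional_if_Gc[OF X] countable_dimensional_if_G1_N[OF X]
    by blast
qed

end
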